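(* There is an absolute constant $C > 0$ such that for every integer $k \geq 4$ there is $n_0 = n_0(k)$ such that for every integer $n \geq n_0$ there exists an arrangement $(P,L)$ of $n$ points and $n$ lines in $\mathbb{R}^2$ (so $|P| = |L| = n$) that contains no $k$-clique in general position and satisfies $|I(P,L)| > n^{4/3 - C/k}$.
   Context: A point-line arrangement $(P,L)$ in $\mathbb{R}^d$ is a pair consisting of a finite set $P$ of points and a finite set $L$ of lines in $\mathbb{R}^d$. $I(P,L)$ denotes the set of incidences, i.e. pairs $(p,\ell)\in P\times L$ with $p\in\ell$. A $k$-clique of $(P,L)$ is a $k$-element subset of $P$ such that each pair of its points is incident to a common line of $L$. A $k$-clique $\tau$ in $\mathbb{R}^d$ is in general position if no hyperplane contains $d+1$ points of $\tau$; thus in $\mathbb{R}^2$ this means that no three points of $\tau$ are collinear. *)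

theory Defs
  imports "HOL-Analysis.Analysis"
begin

definition is_line :: "'a::euclidean_space set \<Rightarrow> bool" where
  "is_line l \<longleftrightarrow> affine l \<and> aff_dim l = 1"

definition is_hyperplane :: "'a::euclidean_space set \<Rightarrow> bool" where
  "is_hyperplane H \<longleftrightarrow> (\<exists>a b. a \<noteq> 0 \<and> H = {x. a \<bullet> x = b})"

definition point_line_arrangement :: "'a::euclidean_space set \<Rightarrow> 'a set set \<Rightarrow> bool" where
  "point_line_arrangement P L \<longleftrightarrow> finite P \<and> finite L \<and> (\<forall>l\<in>L. is_line l)"

definition incidences :: "'a set \<Rightarrow> 'a set set \<Rightarrow> ('a \<times> 'a set) set" where
  "incidences P L = {(p, l) \<in> P \<times> L. p \<in> l}"

text \<open>
  The pairs in a clique are pairs of distinct points: a single point need not lie on a line of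
  \<open>L\<close>. Different pairs may be joined by the same line.
\<close>
definition is_clique :: "nat \<Rightarrow> 'a set \<Rightarrow> 'a set set \<Rightarrow> 'a set \<Rightarrow> bool" where
  "is_clique k P L T \<longleftrightarrow>
     T \<subseteq> P \<and> finite T \<and> card T = k \<and>
     (\<forall>p\<in>T. \<forall>q\<in>T. p \<noteq> q \<longrightarrow> (\<exists>l\<in>L. p \<in> l \<and> q \<in> l))"

definition in_general_position :: "'a::euclidean_space set \<Rightarrow> bool" where
  "in_general_position T \<longleftrightarrow>
     \<not> (\<exists>H S. is_hyperplane H \<and> S \<subseteq> T \<and> card S = DIM('a) + 1 \<and> S \<subseteq> H)"

end

theory Submission
  imports Defs
begin

text \<open>
  In a clique in general position, different pairs of points are joined by different lines, so a
  \<open>k\<close>-clique of this kind uses up \<open>k choose 2\<close> lines, which is quadratic in \<open>k\<close>, while \<open>n\<close> points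
  have at most \<open>n ^ k\<close> subsets of size \<open>k\<close>, an exponent that is linear in \<open>k\<close>. Colour the lines
  of an arrangement at random with \<open>m\<close> colours. A fixed clique becomes monochromatic with
  probability \<open>m ^ (1 - (k choose 2))\<close>, so by the union bound a number of colours \<open>m\<close> of order
  \<open>n powr (4 / k)\<close> suffices for a colouring without monochromatic \<open>k\<close>-cliques in general position
  (\<open>exists_colouring_without_monochromatic\<close>). The richest colour class keeps at least
  a proportion \<open>1 / m\<close> of the incidences and has no such clique (\<open>clique_free_subfamily_of_lines\<close>).

  Applied to a grid with order \<open>n powr (4 / 3)\<close> incidences
  (\<open>arrangement_with_many_incidences\<close>), this leaves order \<open>n powr (4 / 3 - 4 / k)\<close> incidences.
  Discarded lines are replaced by lines that miss all the points, which creates no clique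
  (\<open>pad_with_lines_missing_points\<close>). Constant factors are absorbed by passing from \<open>4 / k\<close> to
  \<open>5 / k\<close>.
\<close>

section \<open>Colourings without monochromatic sets\<close>

text \<open>
  The union bound: among the \<open>m ^ card L\<close> colourings, each \<open>E\<close> in the family is monochromatic in
  only \<open>m * m ^ (card L - e)\<close> of them.
\<close>
lemma exists_colouring_without_monochromatic:
  fixes L :: "'a set" and F :: "'a set set"
  assumes "finite L" "finite F"
    and F: "\<And>E. E \<in> F \<Longrightarrow> E \<subseteq> L \<and> card E = e"
    and "e > 0" "m > 0" and few: "card F < m ^ (e - 1)"
  shows "\<exists>c \<in> L \<rightarrow> {..<m}. \<forall>E\<in>F. \<forall>j. \<exists>l\<in>E. c l \<noteq> j"
proof (cases "F = {}")
  case True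
  then show ?thesis using \<open>m > 0\<close> by (intro bexI[of _ "\<lambda>_. 0"]) auto
next
  case False
  define monochr where "monochr E = (\<Union>j<m. PiE L (\<lambda>l. if l \<in> E then {j} else {..<m}))" for E
  obtain E0 where "E0 \<in> F" using False by blast
  then have "e \<le> card L" using F[of E0] \<open>finite L\<close> card_mono[of L E0] by auto
  have card_monochr_le: "card (monochr E) \<le> m * m ^ (card L - e)" if "E \<in> F" for E
  proof -
    have E: "E \<subseteq> L" "card E = e" using F that by auto
    have "card (PiE L (\<lambda>l. if l \<in> E then {j} else {..<m})) = m ^ (card L - e)" for j
    proof -
      have "card (PiE L (\<lambda>l. if l \<in> E then {j} else {..<m})) =
          (\<Prod>l\<in>L. if l \<in> E then 1 else m)"
        by (subst card_PiE[OF \<open>finite L\<close>]) (intro prod.cong, auto)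
      also have "\<dots> = (\<Prod>l\<in>L - E. m)"
        using \<open>finite L\<close> E by (intro prod.mono_neutral_cong_right) auto
      also have "\<dots> = m ^ (card L - e)"
        using E \<open>finite L\<close> by (simp add: card_Diff_subset finite_subset)
      finally show ?thesis .
    qed
    then show ?thesis
      unfolding monochr_def by (intro order.trans[OF card_UN_le]) auto
  qed
  have "card (\<Union>E\<in>F. monochr E) \<le> (\<Sum>E\<in>F. card (monochr E))"
    by (rule card_UN_le[OF \<open>finite F\<close>])
  also have "\<dots> \<le> card F * (m * m ^ (card L - e))"
    using sum_bounded_above[of F "\<lambda>E. card (monochr E)"] card_monochr_le by simp
  also have "\<dots> < m ^ (e - 1) * (m * m ^ (card L - e))"
    using few \<open>m > 0\<close> by (intro mult_strict_right_mono) auto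
  also have "\<dots> = m ^ ((e - 1) + 1 + (card L - e))"
    by (simp add: power_add)
  also have "\<dots> = card (L \<rightarrow>\<^sub>E {..<m})"
    using \<open>e > 0\<close> \<open>e \<le> card L\<close> \<open>finite L\<close> by (simp add: card_PiE)
  finally have "card (\<Union>E\<in>F. monochr E) < card (L \<rightarrow>\<^sub>E {..<m})" .
  moreover have "finite (\<Union>E\<in>F. monochr E)"
    unfolding monochr_def using \<open>finite F\<close> \<open>finite L\<close>
    by (intro finite_UN_I finite_PiE) auto
  ultimately have "\<not> (L \<rightarrow>\<^sub>E {..<m}) \<subseteq> (\<Union>E\<in>F. monochr E)"
    using card_mono[of "\<Union>E\<in>F. monochr E" "L \<rightarrow>\<^sub>E {..<m}"] by linarith
  then obtain c where c: "c \<in> L \<rightarrow>\<^sub>E {..<m}" "\<And>E. E \<in> F \<Longrightarrow> c \<notin> monochr E"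
    by blast
  have "\<exists>l\<in>E. c l \<noteq> j" if "E \<in> F" for E j
  proof (rule ccontr)
    assume "\<not> ?thesis"
    then have const: "\<forall>l\<in>E. c l = j" by blast
    have "E \<noteq> {}" "E \<subseteq> L" using F[OF that] \<open>e > 0\<close> by auto
    then have "j < m" using const c(1) by (auto simp: PiE_iff)
    then have "c \<in> monochr E"
      unfolding monochr_def using const c(1) by (auto simp: PiE_iff)
    with c(2)[OF that] show False by blast
  qed
  with c(1) show ?thesis by blast
qed

lemma exists_heavy_subset_avoiding_family:
  fixes L :: "'a set" and F :: "'a set set" and w :: "'a \<Rightarrow> nat"
  assumes "finite L" "finite F"
    and F: "\<And>E. E \<in> F \<Longrightarrow> E \<subseteq> L \<and> card E = e"
    and "e > 0" "m > 0" and few: "card F < m ^ (e - 1)"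
  shows "\<exists>L'\<subseteq>L. (\<forall>E\<in>F. \<not> E \<subseteq> L') \<and> sum w L \<le> m * sum w L'"
proof -
  obtain c where c: "c \<in> L \<rightarrow> {..<m}" and avoid: "\<forall>E\<in>F. \<forall>j. \<exists>l\<in>E. c l \<noteq> j"
    using exists_colouring_without_monochromatic[of L F e m] assms by blast
  define W where "W j = sum w {l \<in> L. c l = j}" for j
  have total: "sum w L = (\<Sum>j<m. W j)"
    unfolding W_def using c \<open>finite L\<close>
    by (subst sum.group) auto
  have "\<exists>j<m. sum w L \<le> m * W j"
  proof (rule ccontr)
    assume "\<not> ?thesis"
    then have "(\<Sum>j<m. m * W j) < (\<Sum>j<m. sum w L)"
      using \<open>m > 0\<close> by (intro sum_strict_mono) (auto simp: not_le)
    then show False by (simp add: total flip: sum_distrib_left)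
  qed
  then obtain j where "sum w L \<le> m * W j" by blast
  moreover have "\<not> E \<subseteq> {l \<in> L. c l = j}" if "E \<in> F" for E
    using avoid that by blast
  ultimately show ?thesis
    unfolding W_def by (intro exI[of _ "{l \<in> L. c l = j}"]) auto
qed

section \<open>Cliques in general position\<close>

lemma is_line_eq_affine_hull:
  assumes "is_line l" "p \<in> l" "q \<in> l" "p \<noteq> q"
  shows "l = affine hull {p, q}"
proof (rule affine_dim_equal[symmetric])
  show "affine hull {p, q} \<subseteq> l"
    using assms by (intro hull_minimal) (auto simp: is_line_def)
qed (use assms in \<open>auto simp: is_line_def\<close>)

lemma is_hyperplane_affine_hull_2:
  fixes p q :: "real ^ 2"
  assumes "p \<noteq> q"
  shows "is_hyperplane (affine hull {p, q})"
proof -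
  have "aff_dim {p, q} = int (DIM(real ^ 2)) - 1"
    using assms by simp
  then obtain a b where "a \<noteq> 0" "affine hull {p, q} = {x. a \<bullet> x = b}"
    using iffD1[OF aff_dim_eq_hyperplane[of "{p, q}"]] by auto
  then show ?thesis
    unfolding is_hyperplane_def by (intro exI conjI)
qed

definition spanned_lines :: "(real ^ 2) set \<Rightarrow> (real ^ 2) set set" where
  "spanned_lines T = (\<lambda>B. affine hull B) ` {B. B \<subseteq> T \<and> card B = 2}"

text \<open>If two pairs spanned the same line, that line would contain three points of \<open>T\<close>.\<close>
lemma card_spanned_lines:
  assumes "finite T" and gp: "in_general_position T"
  shows "card (spanned_lines T) = card T choose 2"
proof -
  have sub: "B' \<subseteq> B" if "B \<subseteq> T" "card B = 2" "B' \<subseteq> T" "card B' = 2"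
    "affine hull B = affine hull B'" for B B' :: "(real ^ 2) set"
  proof
    fix r assume "r \<in> B'"
    show "r \<in> B"
    proof (rule ccontr)
      assume "r \<notin> B"
      obtain p q where B: "B = {p, q}" "p \<noteq> q"
        using \<open>card B = 2\<close> by (auto simp: card_2_iff)
      have "is_hyperplane (affine hull B)"
        using is_hyperplane_affine_hull_2 B by blast
      moreover have "insert r B \<subseteq> affine hull B"
        using \<open>r \<in> B'\<close> that(5) hull_subset[of B affine] hull_subset[of B' affine] by auto
      moreover have "insert r B \<subseteq> T"
        using \<open>r \<in> B'\<close> that by auto
      moreover have "card (insert r B) = DIM(real ^ 2) + 1"
        using B \<open>r \<notin> B\<close> by simp
      ultimately show False
        using gp unfolding in_general_position_def by blast
    qed
  qed
  have "inj_on (\<lambda>B. affine hull B) {B. B \<subseteq> T \<and> card B = 2}"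
  proof (rule inj_onI)
    fix B B' :: "(real ^ 2) set"
    assume "B \<in> {B. B \<subseteq> T \<and> card B = 2}" "B' \<in> {B. B \<subseteq> T \<and> card B = 2}"
      "affine hull B = affine hull B'"
    then show "B = B'" using sub[of B B'] sub[of B' B] by auto
  qed
  then show ?thesis
    unfolding spanned_lines_def using n_subsets[OF \<open>finite T\<close>, of 2] by (simp add: card_image)
qed

lemma spanned_lines_of_clique:
  assumes "is_clique k P L T" and lines: "\<And>l. l \<in> L \<Longrightarrow> is_line l"
  shows "spanned_lines T \<subseteq> L"
proof
  fix l assume "l \<in> spanned_lines T"
  then obtain p q where pq: "p \<in> T" "q \<in> T" "p \<noteq> q" and l: "l = affine hull {p, q}"
    by (auto simp: spanned_lines_def card_2_iff)
  obtain l' where "l' \<in> L" "p \<in> l'" "q \<in> l'"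
    using assms(1) pq unfolding is_clique_def by blast
  then show "l \<in> L"
    using is_line_eq_affine_hull[of l' p q] lines pq l by auto
qed

lemma card_incidences:
  assumes "finite P" "finite L"
  shows "card (incidences P L) = (\<Sum>l\<in>L. card {p \<in> P. p \<in> l})"
proof -
  have "incidences P L = (\<lambda>(l, p). (p, l)) ` (SIGMA l:L. {p \<in> P. p \<in> l})"
    by (auto simp: incidences_def image_iff)
  then have "card (incidences P L) = card (SIGMA l:L. {p \<in> P. p \<in> l})"
    by (simp add: card_image inj_on_def split_beta prod_eq_iff)
  also have "\<dots> = (\<Sum>l\<in>L. card {p \<in> P. p \<in> l})"
    using assms by (intro card_SigmaI) auto
  finally show ?thesis .
qed

text \<open>
  The sets to be avoided are the \<open>k choose 2\<close> lines spanned by each \<open>k\<close>-set of points in general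
  position.
\<close>
lemma clique_free_subfamily_of_lines:
  fixes P :: "(real ^ 2) set"
  assumes arr: "point_line_arrangement P L" and "k \<ge> 2" "m > 0"
    and few: "card P choose k < m ^ ((k choose 2) - 1)"
  shows "\<exists>L'\<subseteq>L. \<not> (\<exists>T. is_clique k P L' T \<and> in_general_position T) \<and>
    card (incidences P L) \<le> m * card (incidences P L')"
proof -
  have fin: "finite P" "finite L" and lines: "\<And>l. l \<in> L \<Longrightarrow> is_line l"
    using arr by (auto simp: point_line_arrangement_def)
  define TT where "TT = {T. T \<subseteq> P \<and> card T = k}"
  define F where "F = spanned_lines ` {T \<in> TT. in_general_position T \<and> spanned_lines T \<subseteq> L}"
  have "finite TT" using fin by (simp add: TT_def)
  have "card F \<le> card TT"
    unfolding F_def using \<open>finite TT\<close>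
    by (intro order.trans[OF card_image_le] card_mono) auto
  also have "\<dots> = card P choose k"
    unfolding TT_def by (rule n_subsets[OF fin(1)])
  finally have "card F < m ^ ((k choose 2) - 1)" using few by simp
  moreover have "finite F" using \<open>finite TT\<close> by (simp add: F_def)
  moreover have "E \<subseteq> L \<and> card E = k choose 2" if "E \<in> F" for E
    using that fin card_spanned_lines by (auto simp: F_def TT_def intro: finite_subset)
  moreover have "k choose 2 > 0" using \<open>k \<ge> 2\<close> by simp
  ultimately have "\<exists>L'\<subseteq>L. (\<forall>E\<in>F. \<not> E \<subseteq> L') \<and>
      (\<Sum>l\<in>L. card {p \<in> P. p \<in> l}) \<le> m * (\<Sum>l\<in>L'. card {p \<in> P. p \<in> l})"
    using fin \<open>m > 0\<close> by (intro exists_heavy_subset_avoiding_family) auto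
  then obtain L' where L': "L' \<subseteq> L" "\<forall>E\<in>F. \<not> E \<subseteq> L'"
    and heavy: "(\<Sum>l\<in>L. card {p \<in> P. p \<in> l}) \<le> m * (\<Sum>l\<in>L'. card {p \<in> P. p \<in> l})"
    by blast
  have "\<not> (is_clique k P L' T \<and> in_general_position T)" for T
  proof
    assume T: "is_clique k P L' T \<and> in_general_position T"
    then have "spanned_lines T \<subseteq> L'"
      using spanned_lines_of_clique lines L'(1) by blast
    moreover from this T L'(1) have "spanned_lines T \<in> F"
      by (auto simp: F_def TT_def is_clique_def)
    ultimately show False using L'(2) by blast
  qed
  moreover have "finite L'" using L'(1) fin finite_subset by blast
  ultimately show ?thesis
    using L'(1) heavy fin by (auto simp: card_incidences)
qed

section \<open>Arrangements in the plane\<close>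

lemma is_line_hyperplane:
  fixes a :: "real ^ 2"
  assumes "a \<noteq> 0"
  shows "is_line {x. a \<bullet> x = b}"
  using assms by (simp add: is_line_def affine_hyperplane aff_dim_hyperplane)

lemma is_line_vertical: "is_line {p :: real ^ 2. p $ 1 = c}"
proof -
  have "{p :: real ^ 2. p $ 1 = c} = {p. vector [1, 0] \<bullet> p = c}"
    by (simp add: inner_vec_def sum_2)
  moreover have "(vector [1, 0] :: real ^ 2) \<noteq> 0"
    by (simp add: vec_eq_iff forall_2)
  ultimately show ?thesis using is_line_hyperplane by simp
qed

definition graph_line :: "real \<Rightarrow> real \<Rightarrow> (real ^ 2) set" where
  "graph_line a b = {p. p $ 2 = a * p $ 1 + b}"

lemma is_line_graph_line: "is_line (graph_line a b)"
proof -
  have "graph_line a b = {p. vector [-a, 1] \<bullet> p = b}"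
    by (auto simp: graph_line_def inner_vec_def sum_2)
  moreover have "(vector [-a, 1] :: real ^ 2) \<noteq> 0"
    by (simp add: vec_eq_iff forall_2)
  ultimately show ?thesis using is_line_hyperplane by simp
qed

lemma graph_line_eq_iff: "graph_line a b = graph_line a' b' \<longleftrightarrow> a = a' \<and> b = b'"
proof
  assume eq: "graph_line a b = graph_line a' b'"
  have "vector [x, a * x + b] \<in> graph_line a' b'" for x
    unfolding eq[symmetric] by (simp add: graph_line_def)
  from this[of 0] this[of 1] show "a = a' \<and> b = b'"
    by (simp add: graph_line_def)
qed simp

text \<open>
  Only finitely many vertical lines meet \<open>P\<close>, so the other ones supply as many lines as needed.
\<close>
lemma pad_with_lines_missing_points:
  fixes P :: "(real ^ 2) set"
  assumes arr: "point_line_arrangement P L" and "card L \<le> n"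
  shows "\<exists>L'. L \<subseteq> L' \<and> point_line_arrangement P L' \<and> card L' = n \<and> (\<forall>l\<in>L' - L. l \<inter> P = {})"
proof -
  have fin: "finite P" "finite L" using arr by (auto simp: point_line_arrangement_def)
  define V where "V = (\<lambda>c. {p :: real ^ 2. p $ 1 = c}) ` (UNIV - (\<lambda>p. p $ 1) ` P)"
  have "inj (\<lambda>c. {p :: real ^ 2. p $ 1 = c})"
  proof (rule injI)
    fix c d :: real
    assume "{p :: real ^ 2. p $ 1 = c} = {p. p $ 1 = d}"
    moreover have "vector [c, 0] \<in> {p :: real ^ 2. p $ 1 = c}" by simp
    ultimately have "vector [c, 0] \<in> {p :: real ^ 2. p $ 1 = d}" by blast
    then show "c = d" by simp
  qed
  moreover have "infinite (UNIV - (\<lambda>p. p $ 1) ` P)"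
    using fin by (simp add: infinite_UNIV_char_0 Diff_infinite_finite)
  ultimately have "infinite V"
    unfolding V_def using finite_imageD inj_on_subset by (metis subset_UNIV)
  then have "infinite (V - L)" using fin by simp
  then obtain W where W: "W \<subseteq> V - L" "finite W" "card W = n - card L"
    using infinite_arbitrarily_large by metis
  have "card (L \<union> W) = n"
    using W fin \<open>card L \<le> n\<close> by (subst card_Un_disjoint) auto
  moreover have "is_line l \<and> l \<inter> P = {}" if "l \<in> W" for l
    using that W(1) is_line_vertical by (force simp: V_def)
  ultimately show ?thesis
    using arr W fin by (intro exI[of _ "L \<union> W"]) (auto simp: point_line_arrangement_def)
qed

text \<open>
  Each of the \<open>s ^ 3\<close> lines \<open>y = a * x + b\<close> with \<open>a < s\<close> and \<open>b < s\<^sup>2\<close> contains a point of each of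
  the \<open>s\<close> columns of the grid \<open>{..<s} \<times> {..<2 * s\<^sup>2}\<close>, since \<open>a * x + b < 2 * s\<^sup>2\<close>. Arbitrary
  further points bring the number of points up to \<open>n\<close>.
\<close>
lemma arrangement_with_many_incidences:
  assumes "2 * s ^ 3 \<le> n"
  shows "\<exists>(P :: (real ^ 2) set) L. point_line_arrangement P L \<and> card P = n \<and> card L \<le> n \<and>
    s ^ 4 \<le> card (incidences P L)"
proof -
  define pt :: "nat \<times> nat \<Rightarrow> real ^ 2" where "pt = (\<lambda>(x, y). vector [real x, real y])"
  define ln where "ln = (\<lambda>(a, b). graph_line (real a) (real b))"
  define G where "G = pt ` ({..<s} \<times> {..<2 * s\<^sup>2})"
  define L where "L = ln ` ({..<s} \<times> {..<s\<^sup>2})"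
  have "card G \<le> card ({..<s} \<times> {..<2 * s\<^sup>2})"
    unfolding G_def by (rule card_image_le) simp
  also have "\<dots> \<le> n" using assms by (simp add: power2_eq_square power3_eq_cube)
  finally have "card G \<le> n" .
  have "finite G" by (simp add: G_def)
  have "infinite (UNIV - G)"
    using \<open>finite G\<close> by (simp add: Diff_infinite_finite infinite_UNIV_char_0)
  then obtain Q where Q: "Q \<subseteq> UNIV - G" "finite Q" "card Q = n - card G"
    using infinite_arbitrarily_large by metis
  define P where "P = G \<union> Q"
  have P: "finite P" "G \<subseteq> P" "card P = n"
  proof -
    have "G \<inter> Q = {}" using Q(1) by blast
    then show "card P = n"
      using Q \<open>finite G\<close> \<open>card G \<le> n\<close> by (simp add: P_def card_Un_disjoint)
  qed (use Q \<open>finite G\<close> in \<open>auto simp: P_def\<close>)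
  have "finite L" by (simp add: L_def)
  have "card L \<le> card ({..<s} \<times> {..<s\<^sup>2})"
    unfolding L_def by (rule card_image_le) simp
  also have "\<dots> \<le> n" using assms by (simp add: power2_eq_square power3_eq_cube)
  finally have "card L \<le> n" .
  define inc where "inc = (\<lambda>(x, a, b). (pt (x, a * x + b), ln (a, b)))"
  have "inj_on inc ({..<s} \<times> {..<s} \<times> {..<s\<^sup>2})"
  proof (rule inj_onI, unfold split_paired_all)
    fix x a b x' a' b'
    assume "inc (x, a, b) = inc (x', a', b')"
    then have pts: "pt (x, a * x + b) = pt (x', a' * x' + b')" and "ln (a, b) = ln (a', b')"
      by (auto simp: inc_def)
    from pts have "pt (x, a * x + b) $ 1 = pt (x', a' * x' + b') $ 1" by simp
    then show "(x, a, b) = (x', a', b')"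
      using \<open>ln (a, b) = ln (a', b')\<close> by (simp add: pt_def ln_def graph_line_eq_iff)
  qed
  then have "card (inc ` ({..<s} \<times> {..<s} \<times> {..<s\<^sup>2})) = s ^ 4"
    by (simp add: card_image card_cartesian_product power2_eq_square power4_eq_xxxx)
  moreover have "inc ` ({..<s} \<times> {..<s} \<times> {..<s\<^sup>2}) \<subseteq> incidences P L"
  proof (rule image_subsetI, unfold split_paired_all)
    fix x a b assume *: "(x, a, b) \<in> {..<s} \<times> {..<s} \<times> {..<s\<^sup>2}"
    have "a * x \<le> s * s" using * by (intro mult_mono) auto
    then have "a * x + b < 2 * s\<^sup>2" using * by (simp add: power2_eq_square)
    then have "pt (x, a * x + b) \<in> P" using * P(2) by (auto simp: G_def)
    moreover have "ln (a, b) \<in> L" using * by (auto simp: L_def)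
    moreover have "pt (x, a * x + b) \<in> ln (a, b)" by (simp add: pt_def ln_def graph_line_def)
    ultimately show "inc (x, a, b) \<in> incidences P L" by (simp add: inc_def incidences_def)
  qed
  moreover have "finite (incidences P L)"
    using P(1) \<open>finite L\<close> by (auto simp: incidences_def intro: finite_subset[of _ "P \<times> L"])
  ultimately have "s ^ 4 \<le> card (incidences P L)" using card_mono by metis
  moreover have "point_line_arrangement P L"
    using P(1) \<open>finite L\<close> is_line_graph_line
    by (auto simp: point_line_arrangement_def L_def ln_def)
  ultimately show ?thesis using P(3) \<open>card L \<le> n\<close> by blast
qed

section \<open>Choice of the parameters\<close>

lemma exists_cube_approximation:
  fixes n :: nat
  assumes "n \<ge> 2"
  shows "\<exists>s. 2 * s ^ 3 \<le> n \<and> real n powr (4 / 3) < 256 * real s ^ 4"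
proof -
  define s where "s = (LEAST s. n < 2 * (s + 1) ^ 3)"
  have "n < 2 * (n + 1) ^ 3"
    using self_le_power[of "n + 1" 3] by linarith
  then have upper: "n < 2 * (s + 1) ^ 3" unfolding s_def by (rule LeastI)
  \<comment> \<open>With \<open>s + 1 \<le> 2 * s\<close> the upper bound becomes \<open>n < (4 * s) ^ 3\<close>, whence \<open>256 = 4 ^ 4\<close>.\<close>
  have "s > 0" using upper assms by (cases "s = 0") auto
  then have lower: "2 * s ^ 3 \<le> n"
    using not_less_Least[of "s - 1" "\<lambda>s. n < 2 * (s + 1) ^ 3"] unfolding s_def[symmetric] by simp
  have "2 * (s + 1) ^ 3 \<le> 2 * (2 * s) ^ 3"
    using \<open>s > 0\<close> by (intro mult_left_mono power_mono) auto
  also have "\<dots> \<le> (4 * s) ^ 3" by (simp add: power_mult_distrib)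
  finally have "n < (4 * s) ^ 3" using upper by simp
  then have "real n < (4 * real s) ^ 3"
    by (metis of_nat_less_iff of_nat_mult of_nat_numeral of_nat_power)
  then have "real n powr (4 / 3) < ((4 * real s) ^ 3) powr (4 / 3)"
    by (intro powr_less_mono2) auto
  also have "\<dots> = (4 * real s) ^ 4"
  proof -
    have "(4 * real s) ^ 3 = (4 * real s) powr 3"
      using \<open>s > 0\<close> by simp
    also have "\<dots> powr (4 / 3) = (4 * real s) powr 4" by (simp only: powr_powr) simp
    also have "\<dots> = (4 * real s) ^ 4" using \<open>s > 0\<close> by simp
    finally show ?thesis .
  qed
  also have "\<dots> = 256 * real s ^ 4" by (simp add: power_mult_distrib)
  finally show ?thesis using lower by blast
qed

text \<open>
  The condition on \<open>m\<close> in the union bound is \<open>n ^ k < m ^ ((k choose 2) - 1)\<close>; it holds for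
  \<open>m > n powr (4 / k)\<close> because \<open>4 * ((k choose 2) - 1) = 2 * k\<^sup>2 - 2 * k - 4 \<ge> k\<^sup>2\<close> for \<open>k \<ge> 4\<close>.
\<close>
lemma exists_number_of_colours:
  fixes n k :: nat
  assumes "k \<ge> 4" "n \<ge> 1"
  shows "\<exists>m>0. n ^ k < m ^ ((k choose 2) - 1) \<and> real m \<le> 2 * real n powr (4 / real k)"
proof -
  define e where "e = (k choose 2) - 1"
  define x where "x = real n powr (4 / real k)"
  define m where "m = nat \<lfloor>x\<rfloor> + 1"
  have "x \<ge> 1" unfolding x_def using assms by (intro ge_one_powr_ge_zero) auto
  have m: "x < real m" "real m \<le> 2 * x"
    using \<open>x \<ge> 1\<close> unfolding m_def by linarith+
  have "even (k * (k - 1))" by auto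
  then have "2 * (k choose 2) = k * (k - 1)" by (simp add: choose_two)
  then have "4 * e + 4 = 2 * (k * (k - 1))"
    unfolding e_def using zero_less_binomial[of 2 k] assms by linarith
  moreover obtain j where "k = j + 4" using assms(1) by (metis add.commute le_Suc_ex)
  ultimately have e: "k * k \<le> 4 * e" by (simp add: algebra_simps)
  then have "e > 0" using assms by (cases "e = 0") auto
  have "real n ^ k = real n powr real k" using assms by (simp add: powr_realpow)
  also have "\<dots> \<le> real n powr (4 / real k * real e)"
  proof (rule powr_mono)
    have "real k * real k \<le> 4 * real e"
      using e by (metis of_nat_le_iff of_nat_mult of_nat_numeral)
    then show "real k \<le> 4 / real k * real e" using assms by (simp add: field_simps)
  qed (use assms in auto)
  also have "\<dots> = x ^ e" using assms by (simp add: x_def powr_power mult.commute)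
  also have "\<dots> < real m ^ e"
    using m \<open>x \<ge> 1\<close> \<open>e > 0\<close> by (intro power_strict_mono) auto
  finally have "n ^ k < m ^ e"
    by (metis of_nat_less_iff of_nat_power)
  then show ?thesis using m(2) unfolding e_def x_def m_def by auto
qed

theorem theorem1p3:
  "\<exists>C::real. C > 0 \<and>
     (\<forall>k::nat. k \<ge> 4 \<longrightarrow>
       (\<exists>n0::nat. \<forall>n::nat. n \<ge> n0 \<longrightarrow>
         (\<exists>(P :: (real ^ 2) set) (L :: (real ^ 2) set set).
            point_line_arrangement P L \<and> card P = n \<and> card L = n \<and>
            \<not> (\<exists>T. is_clique k P L T \<and> in_general_position T) \<and>
            real (card (incidences P L)) > real n powr (4 / 3 - C / real k))))"
proof (intro exI[of _ "5::real"] conjI allI impI)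
  fix k :: nat assume "k \<ge> 4"
  \<comment> \<open>From \<open>512 ^ k\<close> on, \<open>n powr (1 / k)\<close> exceeds the constant factor \<open>2 * 256\<close> lost on the way.\<close>
  show "\<exists>n0::nat. \<forall>n::nat. n \<ge> n0 \<longrightarrow>
         (\<exists>(P :: (real ^ 2) set) (L :: (real ^ 2) set set).
            point_line_arrangement P L \<and> card P = n \<and> card L = n \<and>
            \<not> (\<exists>T. is_clique k P L T \<and> in_general_position T) \<and>
            real (card (incidences P L)) > real n powr (4 / 3 - 5 / real k))"
  proof (intro exI[of _ "512 ^ k"] allI impI)
    fix n :: nat assume n: "512 ^ k \<le> n"
    have "(512::nat) \<le> 512 ^ k" using \<open>k \<ge> 4\<close> by (intro self_le_power) auto
    then have "n \<ge> 2" using n by linarith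
    obtain s where s: "2 * s ^ 3 \<le> n" "real n powr (4 / 3) < 256 * real s ^ 4"
      using exists_cube_approximation[OF \<open>n \<ge> 2\<close>] by blast
    obtain P :: "(real ^ 2) set" and L where arr: "point_line_arrangement P L"
      and "card P = n" "card L \<le> n" and inc: "s ^ 4 \<le> card (incidences P L)"
      using arrangement_with_many_incidences[OF s(1)] by blast
    obtain m where m: "m > 0" "n ^ k < m ^ ((k choose 2) - 1)"
        "real m \<le> 2 * real n powr (4 / real k)"
      using exists_number_of_colours[of k n] \<open>k \<ge> 4\<close> \<open>n \<ge> 2\<close> by auto
    have "n choose k \<le> n ^ k"
      using binomial_le_pow[of k n] by (cases "k \<le> n") (auto simp: binomial_eq_0)
    with m(2) have "card P choose k < m ^ ((k choose 2) - 1)"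
      unfolding \<open>card P = n\<close> by linarith
    then obtain L1 where "L1 \<subseteq> L"
      and free: "\<not> (\<exists>T. is_clique k P L1 T \<and> in_general_position T)"
      and inc1: "card (incidences P L) \<le> m * card (incidences P L1)"
      using clique_free_subfamily_of_lines[OF arr, of k m] \<open>k \<ge> 4\<close> m(1) by auto
    have "finite L" "point_line_arrangement P L1"
      using arr \<open>L1 \<subseteq> L\<close> by (auto simp: point_line_arrangement_def intro: finite_subset)
    moreover have "card L1 \<le> n"
      using card_mono[OF \<open>finite L\<close> \<open>L1 \<subseteq> L\<close>] \<open>card L \<le> n\<close> by linarith
    ultimately obtain L2 where L2: "L1 \<subseteq> L2" "point_line_arrangement P L2" "card L2 = n"
      and miss: "\<forall>l\<in>L2 - L1. l \<inter> P = {}"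
      using pad_with_lines_missing_points by blast
    have "is_clique k P L1 T" if "is_clique k P L2 T" for T
      using that miss unfolding is_clique_def by blast
    with free have free2: "\<not> (\<exists>T. is_clique k P L2 T \<and> in_general_position T)" by blast
    have "incidences P L2 = incidences P L1"
      using L2(1) miss by (auto simp: incidences_def)
    then have "s ^ 4 \<le> m * card (incidences P L2)" using inc inc1 by simp
    then have "real s ^ 4 \<le> real m * real (card (incidences P L2))"
      by (metis of_nat_le_iff of_nat_mult of_nat_power)
    also have "\<dots> \<le> 2 * real n powr (4 / real k) * real (card (incidences P L2))"
      using m(3) by (intro mult_right_mono) auto
    finally have "real n powr (4 / 3) <
        512 * real n powr (4 / real k) * real (card (incidences P L2))"
      using s(2) by linarith
    also have "\<dots> \<le> real n powr (1 / real k) * real n powr (4 / real k) *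
        real (card (incidences P L2))"
    proof (intro mult_right_mono)
      have "(512::real) = (512 ^ k) powr (1 / real k)"
        using \<open>k \<ge> 4\<close> by (simp add: powr_powr flip: powr_realpow)
      also have "\<dots> \<le> real n powr (1 / real k)"
        using n by (intro powr_mono2) (auto simp flip: of_nat_le_iff)
      finally show "512 \<le> real n powr (1 / real k)" .
    qed auto
    also have "\<dots> = real n powr (5 / real k) * real (card (incidences P L2))"
      by (simp flip: powr_add add_divide_distrib)
    finally have "real n powr (4 / 3 - 5 / real k) < real (card (incidences P L2))"
      using \<open>n \<ge> 2\<close> by (simp add: powr_diff divide_less_eq mult.commute)
    with L2 free2 \<open>card P = n\<close> show "\<exists>(P :: (real ^ 2) set) (L :: (real ^ 2) set set).
            point_line_arrangement P L \<and> card P = n \<and> card L = n \<and>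
            \<not> (\<exists>T. is_clique k P L T \<and> in_general_position T) \<and>
            real (card (incidences P L)) > real n powr (4 / 3 - 5 / real k)"
      by blast
  qed
qed simp

end
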